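(* For every integer $n\geq 3$, the diameter of the flip graph $\mathcal{G}_n$ is at least $\frac{7n}{3}-34$.
   Context: A triangulation means a simple combinatorial triangulation: a maximal planar graph without self-loops or multiple edges, together with a fixed clockwise rotation of the edges around each vertex (equivalently, an equivalence class of crossing-free drawings on the sphere of a maximal planar graph); all faces are triangles. Two triangulations are considered the same if they are isomorphic as combinatorial triangulations. Flipping an edge $(a,b)$ of a triangulation $G$: removing $(a,b)$ leaves a unique quadrilateral face bounded by a cycle $(a,a',b,b')$; the flip replaces $(a,b)$ by $(a',b')$ drawn inside this face. Only flips whose result is again simple (no multiple edges) are allowed. The flip graph $\mathcal{G}_n$ has as vertex set the distinct (pairwise non-isomorphic) $n$-vertex triangulations, and two triangulations $G,H$ are adjacent if flipping a single edge of $G$ yields (a triangulation isomorphic to) $H$. The diameter is the maximum, over all pairs of vertices of $\mathcal{G}_n$, of the length of a shortest path between them. *)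

theory Defs
  imports Complex_Main
begin

text \<open>
  Combinatorial triangulations on the vertex set {0..<n}, encoded by their set of
  oriented (clockwise) triangular faces. An oriented face (a,b,c) is stored together
  with its cyclic rotations (b,c,a), (c,a,b). The clockwise rotation around a vertex v
  is the map a \<mapsto> c for faces (v,a,c); it is a cyclic permutation of the neighbours
  of v. The conditions below say: every face has three distinct vertices, every dart
  (directed edge) lies in exactly one face, every reverse dart is a dart, the rotation
  at every vertex is a single cycle, the graph is connected, and the Euler
  characteristic equals 2 (with 3F = 2E this is E = 3n - 6). This is exactly a
  simple combinatorial triangulation of the sphere.
\<close>

type_synonym tri = "(nat \<times> nat \<times> nat) set"

definition darts :: "tri \<Rightarrow> (nat \<times> nat) set" where
  "darts F = {(a, b). \<exists>c. (a, b, c) \<in> F}"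

definition tri_edges :: "tri \<Rightarrow> nat set set" where
  "tri_edges F = {{a, b} | a b. (a, b) \<in> darts F}"

definition nbrs :: "tri \<Rightarrow> nat \<Rightarrow> nat set" where
  "nbrs F v = {a. (v, a) \<in> darts F}"

definition rot :: "tri \<Rightarrow> nat \<Rightarrow> nat \<Rightarrow> nat" where
  "rot F v a = (THE c. (v, a, c) \<in> F)"

definition is_triangulation :: "nat \<Rightarrow> tri \<Rightarrow> bool" where
  "is_triangulation n F \<longleftrightarrow>
     (\<forall>a b c. (a, b, c) \<in> F \<longrightarrow>
        a < n \<and> b < n \<and> c < n \<and> a \<noteq> b \<and> b \<noteq> c \<and> a \<noteq> c \<and> (b, c, a) \<in> F) \<and>
     (\<forall>a b c c'. (a, b, c) \<in> F \<and> (a, b, c') \<in> F \<longrightarrow> c = c') \<and>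
     (\<forall>a b. (a, b) \<in> darts F \<longrightarrow> (b, a) \<in> darts F) \<and>
     (\<forall>v<n. \<forall>a\<in>nbrs F v. \<forall>a'\<in>nbrs F v. \<exists>k. (rot F v ^^ k) a = a') \<and>
     (\<forall>u<n. \<forall>v<n. (\<lambda>x y. (x, y) \<in> darts F)\<^sup>*\<^sup>* u v) \<and>
     int (card (tri_edges F)) = 3 * int n - 6"

definition rots :: "nat \<Rightarrow> nat \<Rightarrow> nat \<Rightarrow> tri" where
  "rots a b c = {(a, b, c), (b, c, a), (c, a, b)}"

text \<open>Flipping edge ab with incident faces (a,b,c) and (b,a,d): the quadrilateral
  is b,c,a,d; the new diagonal is cd; only allowed if cd is not already an edge.\<close>
definition flip_rel :: "nat \<Rightarrow> tri \<Rightarrow> tri \<Rightarrow> bool" where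
  "flip_rel n F F' \<longleftrightarrow> is_triangulation n F \<and>
     (\<exists>a b c d. (a, b, c) \<in> F \<and> (b, a, d) \<in> F \<and> c \<noteq> d \<and> {c, d} \<notin> tri_edges F \<and>
        F' = (F - rots a b c - rots b a d) \<union> rots c a d \<union> rots d b c)"

definition tri_iso :: "nat \<Rightarrow> tri \<Rightarrow> tri \<Rightarrow> bool" where
  "tri_iso n F F' \<longleftrightarrow>
     (\<exists>\<phi>. bij_betw \<phi> {..<n} {..<n} \<and> F' = (\<lambda>(a, b, c). (\<phi> a, \<phi> b, \<phi> c)) ` F)"

text \<open>Adjacency in the flip graph (on representatives): flipping one edge of G yields
  a triangulation isomorphic to H.\<close>
definition flip_adj :: "nat \<Rightarrow> tri \<Rightarrow> tri \<Rightarrow> bool" where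
  "flip_adj n G H \<longleftrightarrow> is_triangulation n H \<and> (\<exists>H'. flip_rel n G H' \<and> tri_iso n H' H)"

definition flip_path :: "nat \<Rightarrow> nat \<Rightarrow> tri \<Rightarrow> tri \<Rightarrow> bool" where
  "flip_path n k G H \<longleftrightarrow> (flip_adj n ^^ k) G H"

end

theory Submission
  imports Defs
begin

text \<open>
  A flip creates one edge, so along any flip path from G to H, the vertices being matched up
  by some bijection, the number of flips is at least 3n - 6 minus the number of common edges.
  Let H have two vertices adjacent to everything else, the remaining edges forming a path.
  Obtain G from the cube of a path on m vertices, about n/3 many, by inserting a vertex into
  (almost) every face. Then G has maximum degree 12 and every edge of G meets one of the m
  original vertices. Hence at most 24 common edges meet the two hubs of H, and at most 2m
  common edges lie on the path, which leaves at least 7n/3 - 34 flips.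
\<close>

section \<open>Membership rules for darts, neighbours, edges and rotated faces\<close>

lemma darts_iff: "(a, b) \<in> darts F \<longleftrightarrow> (\<exists>c. (a, b, c) \<in> F)"
  by (simp add: darts_def)

lemma nbrs_iff: "b \<in> nbrs F a \<longleftrightarrow> (a, b) \<in> darts F"
  by (simp add: nbrs_def)

lemma tri_edges_altdef: "tri_edges F = (\<lambda>(a, b). {a, b}) ` darts F"
  by (auto simp: tri_edges_def)

lemma rots_iff:
  "(x, y, z) \<in> rots a b c \<longleftrightarrow>
     x = a \<and> y = b \<and> z = c \<or> x = b \<and> y = c \<and> z = a \<or> x = c \<and> y = a \<and> z = b"
  by (auto simp: rots_def)

section \<open>Basic properties of triangulations\<close>

lemma is_triangulation_face:
  assumes "is_triangulation n F" "(a, b, c) \<in> F"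
  shows "a < n" "b < n" "c < n" "a \<noteq> b" "b \<noteq> c" "a \<noteq> c" "(b, c, a) \<in> F" "(c, a, b) \<in> F"
proof -
  have faces: "\<forall>a b c. (a, b, c) \<in> F \<longrightarrow>
      a < n \<and> b < n \<and> c < n \<and> a \<noteq> b \<and> b \<noteq> c \<and> a \<noteq> c \<and> (b, c, a) \<in> F"
    using assms(1) unfolding is_triangulation_def by (rule conjunct1)
  with assms(2) show "a < n" "b < n" "c < n" "a \<noteq> b" "b \<noteq> c" "a \<noteq> c" and bca: "(b, c, a) \<in> F"
    by simp_all
  show "(c, a, b) \<in> F"
    using faces bca by simp
qed

lemma is_triangulation_unique:
  assumes "is_triangulation n F" "(a, b, c) \<in> F" "(a, b, c') \<in> F"
  shows "c = c'"
  using assms unfolding is_triangulation_def by simp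

lemma is_triangulation_sym:
  assumes "is_triangulation n F" "(a, b) \<in> darts F"
  shows "(b, a) \<in> darts F"
  using assms unfolding is_triangulation_def by simp

lemma is_triangulation_darts:
  assumes "is_triangulation n F" "(a, b) \<in> darts F"
  shows "a < n" "b < n" "a \<noteq> b"
  using assms is_triangulation_face unfolding darts_iff by blast+

lemma is_triangulation_finite:
  assumes "is_triangulation n F"
  shows "finite F"
proof (rule finite_subset)
  show "F \<subseteq> {..<n} \<times> {..<n} \<times> {..<n}"
    using is_triangulation_face(1-3)[OF assms] by auto
qed simp

lemma is_triangulation_finite_nbrs:
  assumes "is_triangulation n F"
  shows "finite (nbrs F v)"
  by (rule finite_subset[of _ "{..<n}"])
    (use is_triangulation_darts[OF assms] in \<open>auto simp: nbrs_iff\<close>)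

lemma is_triangulation_finite_edges:
  assumes "is_triangulation n F"
  shows "finite (tri_edges F)"
proof -
  have "darts F \<subseteq> {..<n} \<times> {..<n}"
    using is_triangulation_darts[OF assms] by auto
  then have "finite (darts F)"
    by (rule finite_subset) simp
  then show ?thesis
    by (simp add: tri_edges_altdef)
qed

section \<open>The rotation at a vertex as reachability in its link\<close>

lemma rot_eq:
  assumes "\<And>a b c c'. (a, b, c) \<in> F \<Longrightarrow> (a, b, c') \<in> F \<Longrightarrow> c = c'" "(v, x, y) \<in> F"
  shows "rot F v x = y"
  unfolding rot_def using assms by blast

text \<open>The graph of the map \<open>rot F v\<close>, written as a relation so that the
  single-cycle condition becomes reachability. Inserting a vertex then only subdivides steps, and no
  iterates or definite descriptions have to be tracked.\<close>

abbreviation link_step :: "tri \<Rightarrow> nat \<Rightarrow> nat \<Rightarrow> nat \<Rightarrow> bool" where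
  "link_step F v x y \<equiv> (v, x, y) \<in> F"

lemma rot_orbit_if_link_reachable:
  assumes uniq: "\<And>a b c c'. (a, b, c) \<in> F \<Longrightarrow> (a, b, c') \<in> F \<Longrightarrow> c = c'"
    and "(link_step F v)\<^sup>*\<^sup>* x y"
  shows "\<exists>k. (rot F v ^^ k) x = y"
  using assms(2)
proof (induction rule: rtranclp_induct)
  case base
  show ?case by (rule exI[of _ 0]) simp
next
  case (step y z)
  then obtain k where "(rot F v ^^ k) x = y" by blast
  then have "(rot F v ^^ Suc k) x = z"
    using rot_eq[OF uniq step.hyps(2)] by simp
  then show ?case by blast
qed

lemma link_reachable:
  assumes tri: "is_triangulation n F" and x: "x \<in> nbrs F v" and y: "y \<in> nbrs F v"
  shows "(link_step F v)\<^sup>*\<^sup>* x y"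
proof -
  have "v < n"
    using x is_triangulation_darts[OF tri] by (auto simp: nbrs_iff)
  then obtain k where k: "(rot F v ^^ k) x = y"
    using tri x y unfolding is_triangulation_def by meson
  have "(rot F v ^^ k) x \<in> nbrs F v \<and> (link_step F v)\<^sup>*\<^sup>* x ((rot F v ^^ k) x)" for k
  proof (induction k)
    case 0
    show ?case using x by simp
  next
    case (Suc k)
    let ?y = "(rot F v ^^ k) x"
    obtain z where z: "(v, ?y, z) \<in> F"
      using Suc by (auto simp: nbrs_iff darts_iff)
    have "rot F v ?y = z"
      by (rule rot_eq[OF _ z]) (rule is_triangulation_unique[OF tri])
    \<comment> \<open>Rotating the face gives the dart \<open>(z, v)\<close>, whose reverse must be
      a dart as well; so the rotation never leaves the neighbours of \<open>v\<close>.\<close>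
    moreover have "z \<in> nbrs F v"
      using is_triangulation_face(8)[OF tri z] is_triangulation_sym[OF tri]
      unfolding nbrs_iff darts_iff by blast
    ultimately show ?case
      using Suc z by (auto intro: rtranclp.rtrancl_into_rtrancl)
  qed
  from this[of k] show ?thesis
    using k by simp
qed

section \<open>Inserting a vertex into a face\<close>

text \<open>Each new triangle keeps one of the darts ab, bc, ca of the face it subdivides, so all
  orientations stay consistent.\<close>

definition insert_vertex :: "nat \<Rightarrow> nat \<Rightarrow> nat \<Rightarrow> nat \<Rightarrow> tri \<Rightarrow> tri" where
  "insert_vertex v a b c F = (F - rots a b c) \<union> rots a b v \<union> rots b c v \<union> rots c a v"

lemma insert_vertex_iff:
  "(x, y, z) \<in> insert_vertex v a b c F \<longleftrightarrow>
     (x, y, z) \<in> F \<and> (x, y, z) \<notin> rots a b c \<or>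
     (x, y, z) \<in> rots a b v \<or> (x, y, z) \<in> rots b c v \<or> (x, y, z) \<in> rots c a v"
  by (auto simp: insert_vertex_def)

text \<open>No dart is lost: the three darts of the removed face reappear, one in each new face.
  What is gained are the two directions of the three spokes at \<open>v\<close>.\<close>

lemma darts_insert_vertex:
  assumes "is_triangulation n F" "(a, b, c) \<in> F"
  shows "darts (insert_vertex v a b c F) =
    darts F \<union> {(a, v), (v, a), (b, v), (v, b), (c, v), (v, c)}"
proof -
  let ?F = "insert_vertex v a b c F"
  have new: "(x, y) \<in> darts ?F" if "(x, y, z) \<in> rots a b v \<union> rots b c v \<union> rots c a v" for x y z
    using that unfolding darts_iff insert_vertex_iff by blast
  have "(x, y) \<in> darts ?F" if "(x, y, z) \<in> F" for x y z
  proof (cases "(x, y, z) \<in> rots a b c")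
    case True
    then show ?thesis
      by (intro new[of x y v]) (auto simp: rots_iff)
  next
    case False
    then show ?thesis
      using that unfolding darts_iff insert_vertex_iff by blast
  qed
  moreover have "{(a, v), (v, a), (b, v), (v, b), (c, v), (v, c)} \<subseteq> darts ?F"
    using new[of a v c] new[of v c a] new[of b v a] new[of v a b] new[of c v b] new[of v b c]
    by (simp add: rots_def)
  moreover have "darts ?F \<subseteq> darts F \<union> {(a, v), (v, a), (b, v), (v, b), (c, v), (v, c)}"
  proof (rule subrelI)
    fix x y assume "(x, y) \<in> darts ?F"
    then obtain z where z: "(x, y, z) \<in> ?F"
      by (auto simp: darts_iff)
    have "(a, b) \<in> darts F" "(b, c) \<in> darts F" "(c, a) \<in> darts F"
      using assms(2) is_triangulation_face(7,8)[OF assms] unfolding darts_iff by blast+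
    moreover have "(x, y) \<in> darts F" if "(x, y, z) \<in> F"
      using that unfolding darts_iff by blast
    ultimately show "(x, y) \<in> darts F \<union> {(a, v), (v, a), (b, v), (v, b), (c, v), (v, c)}"
      using z unfolding insert_vertex_iff rots_iff by (elim disjE conjE) simp_all
  qed
  ultimately show ?thesis
    unfolding darts_def[of F] by blast
qed

lemma nbrs_insert_vertex:
  assumes "is_triangulation n F" "(a, b, c) \<in> F"
  shows "nbrs (insert_vertex n a b c F) v =
    (if v = n then {a, b, c} else if v \<in> {a, b, c} then insert n (nbrs F v) else nbrs F v)"
  using is_triangulation_darts[OF assms(1)] is_triangulation_face[OF assms]
  by (auto simp: nbrs_def darts_insert_vertex[OF assms])

text \<open>Every face is stored with its three rotations, so one face replaced by three means 3
  triples replaced by 9.\<close>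

lemma card_insert_vertex:
  assumes "is_triangulation n F" "(a, b, c) \<in> F"
  shows "card (insert_vertex n a b c F) = card F + 6"
proof -
  note f = is_triangulation_face[OF assms] assms(2)
  have fin: "finite F"
    by (rule is_triangulation_finite[OF assms(1)])
  let ?N = "rots a b n \<union> rots b c n \<union> rots c a n"
  have sub: "rots a b c \<subseteq> F" and c3: "card (rots a b c) = 3" and c9: "card ?N = 9"
    using f by (auto simp: rots_def)
  have "F \<inter> ?N = {}"
    using is_triangulation_face(1-3)[OF assms(1)] by (fastforce simp: rots_def)
  then have "card ((F - rots a b c) \<union> ?N) = card (F - rots a b c) + card ?N"
    using fin by (intro card_Un_disjoint) (auto simp: rots_def)
  moreover have "card (F - rots a b c) = card F - 3" "3 \<le> card F"
    using card_Diff_subset[OF finite_subset[OF sub fin] sub] card_mono[OF fin sub] c3 by simp_all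
  ultimately show ?thesis
    using c9 by (simp add: insert_vertex_def Un_assoc)
qed

lemma card_tri_edges_insert_vertex:
  assumes "is_triangulation n F" "(a, b, c) \<in> F"
  shows "card (tri_edges (insert_vertex n a b c F)) = card (tri_edges F) + 3"
proof -
  note f = is_triangulation_face[OF assms]
  have "tri_edges (insert_vertex n a b c F) = tri_edges F \<union> {{a, n}, {b, n}, {c, n}}"
    unfolding tri_edges_altdef darts_insert_vertex[OF assms] by auto
  moreover have "tri_edges F \<inter> {{a, n}, {b, n}, {c, n}} = {}"
    using is_triangulation_darts[OF assms(1)]
    by (fastforce simp: tri_edges_altdef doubleton_eq_iff)
  moreover have "card {{a, n}, {b, n}, {c, n}} = 3"
    using f by (auto simp: doubleton_eq_iff)
  ultimately show ?thesis
    using is_triangulation_finite_edges[OF assms(1)]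
    by (metis card_Un_disjoint finite.emptyI finite.insertI)
qed

text \<open>The rotation at the new vertex is the cycle a, b, c; at each corner of the subdivided
  face one rotation step is split in two by the new vertex; elsewhere the rotations are unchanged.
  One vertex and three edges are added, which preserves the Euler count.\<close>

lemma is_triangulation_insert_vertex:
  assumes tri: "is_triangulation n F" and face: "(a, b, c) \<in> F"
  shows "is_triangulation (Suc n) (insert_vertex n a b c F)"
proof -
  let ?F = "insert_vertex n a b c F"
  note f = is_triangulation_face[OF tri face] face
  note darts' = darts_insert_vertex[OF tri face]
  note nbrs' = nbrs_insert_vertex[OF tri face]
  have lt: "x < n" "y < n" "z < n" if "(x, y, z) \<in> F" for x y z
    using is_triangulation_face[OF tri that] by auto
  have faces: "x < Suc n \<and> y < Suc n \<and> z < Suc n \<and> x \<noteq> y \<and> y \<noteq> z \<and> x \<noteq> z \<and> (y, z, x) \<in> ?F"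
    if "(x, y, z) \<in> ?F" for x y z
    using that f is_triangulation_face[OF tri, of x y z]
    unfolding insert_vertex_iff rots_iff by (elim disjE conjE) auto
  let ?N = "rots a b n \<union> rots b c n \<union> rots c a n"
  \<comment> \<open>A dart shared by a surviving and a new face joins two old vertices, hence is a
    dart of the removed face; but that dart lay in no other face of \<open>F\<close>.\<close>
  have old_new: False if xyz: "(x, y, z) \<in> F" "(x, y, z) \<notin> rots a b c" and "(x, y, z') \<in> ?N" for x y z z'
  proof -
    have "x \<noteq> n" "y \<noteq> n"
      using lt[OF xyz(1)] by simp_all
    then have "x = a \<and> y = b \<or> x = b \<and> y = c \<or> x = c \<and> y = a"
      using that(3) by (auto simp: rots_iff)
    then obtain w where "(x, y, w) \<in> rots a b c"
      by (auto simp: rots_iff)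
    moreover from this have "(x, y, w) \<in> F"
      using f(7-9) by (auto simp: rots_iff)
    ultimately show False
      using xyz is_triangulation_unique[OF tri] by metis
  qed
  have new_new: "z = z'" if "(x, y, z) \<in> ?N" "(x, y, z') \<in> ?N" for x y z z'
    using that f(1-6) unfolding Un_iff rots_iff by (elim disjE conjE) simp_all
  have uniq: "z = z'" if "(x, y, z) \<in> ?F" "(x, y, z') \<in> ?F" for x y z z'
    using that old_new[of x y z z'] old_new[of x y z' z] new_new[of x y z z']
      is_triangulation_unique[OF tri, of x y z z']
    unfolding insert_vertex_def Un_iff Diff_iff by satx
  have sym: "(y, x) \<in> darts ?F" if "(x, y) \<in> darts ?F" for x y
    using that is_triangulation_sym[OF tri] unfolding darts' by auto
  have link: "(link_step ?F v)\<^sup>*\<^sup>* x y" if x: "x \<in> nbrs ?F v" and y: "y \<in> nbrs ?F v" for v x y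
  proof (cases "v = n")
    case True
    have "link_step ?F n a b" "link_step ?F n b c" "link_step ?F n c a"
      by (auto simp: insert_vertex_iff rots_iff)
    then have "(link_step ?F n)\<^sup>*\<^sup>* a b" "(link_step ?F n)\<^sup>*\<^sup>* b c" "(link_step ?F n)\<^sup>*\<^sup>* c a"
      by blast+
    then show ?thesis
      using x y True by (auto simp: nbrs' intro: rtranclp_trans)
  next
    case False
    \<comment> \<open>An old step survives, or becomes the detour \<open>p\<close>,
      \<open>n\<close>, \<open>q\<close> if it belonged to the removed face.\<close>
    have step: "(link_step ?F v)\<^sup>*\<^sup>* p q" if "link_step F v p q" for p q
    proof (cases "(v, p, q) \<in> rots a b c")
      case True
      then have "link_step ?F v p n" "link_step ?F v n q"
        by (auto simp: insert_vertex_iff rots_iff)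
      then show ?thesis by (meson r_into_rtranclp rtranclp.rtrancl_into_rtrancl)
    next
      case False
      then show ?thesis using that by (auto simp: insert_vertex_iff)
    qed
    have old: "(link_step ?F v)\<^sup>*\<^sup>* p q" if "p \<in> nbrs F v" "q \<in> nbrs F v" for p q
      using link_reachable[OF tri that]
      by (induction rule: rtranclp_induct) (auto intro: rtranclp_trans step)
    show ?thesis
    proof (cases "v \<in> {a, b, c}")
      case True
      then obtain p q where pq: "(v, p, q) \<in> rots a b c"
        by (auto simp: rots_iff)
      then have "(v, p, q) \<in> F"
        using f by (auto simp: rots_iff)
      then have p: "p \<in> nbrs F v" and q: "q \<in> nbrs F v"
        using is_triangulation_face(8)[OF tri] is_triangulation_sym[OF tri]
        unfolding nbrs_iff darts_iff by blast+
      \<comment> \<open>The new vertex is entered from \<open>p\<close> and left towards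
        \<open>q\<close>, so it lies on the same cycle as the old neighbours.\<close>
      have "link_step ?F v p n" "link_step ?F v n q"
        using pq by (auto simp: insert_vertex_iff rots_iff)
      then have "(link_step ?F v)\<^sup>*\<^sup>* r n" "(link_step ?F v)\<^sup>*\<^sup>* n r" if "r \<in> nbrs F v" for r
        using old[OF that p] old[OF q that]
        by (meson rtranclp.rtrancl_into_rtrancl converse_rtranclp_into_rtranclp)+
      then show ?thesis
        using x y True False old by (auto simp: nbrs')
    next
      case False
      then show ?thesis
        using x y \<open>v \<noteq> n\<close> old by (simp add: nbrs')
    qed
  qed
  have conn: "(\<lambda>x y. (x, y) \<in> darts ?F)\<^sup>*\<^sup>* u v" if "u < Suc n" "v < Suc n" for u v
  proof -
    have old: "(\<lambda>x y. (x, y) \<in> darts ?F)\<^sup>*\<^sup>* u v" if "u < n" "v < n" for u v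
    proof -
      have "(\<lambda>x y. (x, y) \<in> darts F)\<^sup>*\<^sup>* u v"
        using tri that unfolding is_triangulation_def by blast
      then show ?thesis
        by (rule rtranclp_mono[THEN predicate2D, rotated]) (auto simp: darts')
    qed
    have "(a, n) \<in> darts ?F" "(n, a) \<in> darts ?F"
      by (auto simp: darts')
    then have "(\<lambda>x y. (x, y) \<in> darts ?F)\<^sup>*\<^sup>* w n" "(\<lambda>x y. (x, y) \<in> darts ?F)\<^sup>*\<^sup>* n w"
      if "w < n" for w
      using old[OF that f(1)] old[OF f(1) that]
      by (meson rtranclp.rtrancl_into_rtrancl converse_rtranclp_into_rtranclp)+
    then show ?thesis
      using that old by (auto simp: less_Suc_eq)
  qed
  have card: "int (card (tri_edges ?F)) = 3 * int (Suc n) - 6"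
    using tri unfolding card_tri_edges_insert_vertex[OF tri face] is_triangulation_def by simp
  show ?thesis
    unfolding is_triangulation_def
    using faces uniq sym link card by (auto intro!: rot_orbit_if_link_reachable conn)
qed

text \<open>Two oppositely oriented triangles glued along their boundary: the smallest sphere
  allowed, and the start of both constructions.\<close>

lemma is_triangulation_triangle: "is_triangulation 3 (rots 0 1 2 \<union> rots 0 2 1)"
proof -
  let ?F = "rots 0 1 2 \<union> rots 0 2 1 :: tri"
  have uniq: "c = c'" if "(a, b, c) \<in> ?F" "(a, b, c') \<in> ?F" for a b c c'
    using that by (auto simp: rots_iff)
  have D: "darts ?F = {(0, 1), (1, 0), (0, 2), (2, 0), (1, 2), (2, 1)}"
    by (auto simp: darts_def rots_iff)
  have E: "tri_edges ?F = {{0, 1}, {0, 2}, {1, 2}}"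
    unfolding tri_edges_altdef D by auto
  have card: "card (tri_edges ?F) = 3"
    unfolding E by (simp add: doubleton_eq_iff)
  have link: "(link_step ?F v)\<^sup>*\<^sup>* x y" if "x \<in> nbrs ?F v" "y \<in> nbrs ?F v" for v x y
  proof (cases "x = y")
    case False
    then have "link_step ?F v x y"
      using that unfolding nbrs_iff D by (auto simp: rots_iff)
    then show ?thesis by blast
  qed simp
  have conn: "(\<lambda>x y. (x, y) \<in> darts ?F)\<^sup>*\<^sup>* u v" if "u < 3" "v < 3" for u v
  proof (cases "u = v")
    case False
    then have "(u, v) \<in> darts ?F"
      using that unfolding D by auto
    then show ?thesis by blast
  qed simp
  show ?thesis
    unfolding is_triangulation_def
  proof (intro conjI allI impI ballI)
    show "\<exists>k. (rot ?F v ^^ k) a = a'" if "a \<in> nbrs ?F v" "a' \<in> nbrs ?F v" for v a a'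
      by (rule rot_orbit_if_link_reachable[OF _ link[OF that]]) (erule (1) uniq)
    show "c = c'" if "(a, b, c) \<in> ?F \<and> (a, b, c') \<in> ?F" for a b c c'
      using that uniq[of a b c c'] by blast
    show "(\<lambda>x y. (x, y) \<in> darts ?F)\<^sup>*\<^sup>* u v" if "u < 3" "v < 3" for u v
      by (rule conn[OF that])
    show "int (card (tri_edges ?F)) = 3 * int 3 - 6"
      unfolding card by simp
    show "(b, a) \<in> darts ?F" if "(a, b) \<in> darts ?F" for a b
      using that unfolding D by auto
  qed (auto simp: rots_iff)
qed

section \<open>The two triangulations\<close>

text \<open>Vertex m is always put into the face on its three predecessors. The number 6m - 12 is 2m
  - 4 faces times three rotations. The last face is named through \<open>y\<close> and
  \<open>z\<close> because its orientation varies with m.\<close>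

lemma ex_triangulation_path_cube:
  assumes "m \<ge> 3"
  shows "\<exists>F. is_triangulation m F \<and> card F + 12 = 6 * m \<and>
    (\<forall>i j. (i, j) \<in> darts F \<longrightarrow> j \<le> i + 3 \<and> i \<le> j + 3) \<and>
    (\<exists>y z. (m - 3, y, z) \<in> F \<and> {y, z} = {m - 2, m - 1})"
  using assms
proof (induction m rule: dec_induct)
  case base
  let ?F = "rots 0 1 2 \<union> rots 0 2 1 :: tri"
  have "card ?F + 12 = 6 * 3"
    by (simp add: rots_def)
  moreover have "j \<le> i + 3 \<and> i \<le> j + 3" if "(i, j) \<in> darts ?F" for i j
    using that by (auto simp: darts_def rots_iff)
  moreover have "(3 - 3, 1, 2) \<in> ?F" "{1, 2} = {3 - 2, 3 - 1 :: nat}"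
    by (auto simp: rots_def)
  ultimately show ?case
    using is_triangulation_triangle by blast
next
  case (step m)
  then obtain F y z where F: "is_triangulation m F" "card F + 12 = 6 * m"
    "\<And>i j. (i, j) \<in> darts F \<Longrightarrow> j \<le> i + 3 \<and> i \<le> j + 3"
    and face: "(m - 3, y, z) \<in> F" and yz: "{y, z} = {m - 2, m - 1}"
    by blast
  let ?F = "insert_vertex m (m - 3) y z F"
  have "is_triangulation (Suc m) ?F"
    by (rule is_triangulation_insert_vertex[OF F(1) face])
  moreover have "card ?F + 12 = 6 * Suc m"
    using F(2) card_insert_vertex[OF F(1) face] by simp
  moreover have "j \<le> i + 3 \<and> i \<le> j + 3" if "(i, j) \<in> darts ?F" for i j
    using that F(3)[of i j] yz step.hyps unfolding darts_insert_vertex[OF F(1) face]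
    by (auto simp: doubleton_eq_iff)
  moreover have "\<exists>y z. (Suc m - 3, y, z) \<in> ?F \<and> {y, z} = {Suc m - 2, Suc m - 1}"
  proof -
    \<comment> \<open>Whichever of \<open>y\<close> and \<open>z\<close> equals \<open>m - 2\<close>
      starts one of these two triples, giving the face for the next insertion.\<close>
    have "(y, z, m) \<in> ?F" "(z, m, y) \<in> ?F"
      by (auto simp: insert_vertex_iff rots_iff)
    moreover have "Suc m - 3 = m - 2" "Suc m - 2 = m - 1" "Suc m - 1 = m"
      using step.hyps by auto
    ultimately show ?thesis
      using yz by (metis doubleton_eq_iff)
  qed
  ultimately show ?case by blast
qed

text \<open>The path cube on m vertices has 2m - 4 faces, and j of them receive a new vertex. New
  vertices see only original ones, so the original vertices cover all edges. An original vertex has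
  degree at most 6 and at most 6 faces around it, so its degree at most doubles.\<close>

lemma ex_triangulation_small_cover:
  assumes "m \<ge> 3" "j + 4 \<le> 2 * m"
  shows "\<exists>F. is_triangulation (m + j) F \<and>
    (\<forall>a b. (a, b) \<in> darts F \<longrightarrow> a < m \<or> b < m) \<and> (\<forall>v. card (nbrs F v) \<le> 12)"
proof -
  \<comment> \<open>When a vertex is inserted into an old face at \<open>v\<close>, the degree of \<open>v\<close> goes up by one and the
    number of old faces at \<open>v\<close> goes down by one.\<close>
  define old :: "tri \<Rightarrow> tri" where "old F = F \<inter> {..<m} \<times> {..<m} \<times> {..<m}" for F
  have old_iff: "(a, b, c) \<in> old F \<longleftrightarrow> (a, b, c) \<in> F \<and> a < m \<and> b < m \<and> c < m" for a b c F
    by (auto simp: old_def)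
  have "\<exists>F. is_triangulation (m + j) F \<and> (\<forall>a b. (a, b) \<in> darts F \<longrightarrow> a < m \<or> b < m) \<and>
    card (old F) + 3 * j + 12 = 6 * m \<and>
    (\<forall>v. card (nbrs F v) + card (nbrs (old F) v) \<le> 12)"
    using assms(2)
  proof (induction j)
    case 0
    obtain F where F: "is_triangulation m F" "card F + 12 = 6 * m"
      "\<And>i j. (i, j) \<in> darts F \<Longrightarrow> j \<le> i + 3 \<and> i \<le> j + 3"
      using ex_triangulation_path_cube[OF assms(1)] by blast
    have "old F = F"
      using is_triangulation_face(1-3)[OF F(1)] by (auto simp: old_def)
    moreover have "card (nbrs F v) \<le> 6" for v
    proof -
      have "nbrs F v \<subseteq> {v - 3..v + 3} - {v}"
        using F(3) is_triangulation_darts(3)[OF F(1)] by (force simp: nbrs_iff)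
      then have "card (nbrs F v) \<le> card ({v - 3..v + 3} - {v})"
        by (intro card_mono) auto
      also have "\<dots> \<le> 6" by simp
      finally show ?thesis .
    qed
    \<comment> \<open>At the start all faces are old, so both summands of the invariant are the
      degree.\<close>
    then have "card (nbrs F v) + card (nbrs F v) \<le> 12" for v
      by (smt (verit, best) add_mono numeral_Bit0)
    ultimately show ?case
      using F is_triangulation_darts[OF F(1)] by (intro exI[of _ F]) auto
  next
    case (Suc j)
    then obtain F where F: "is_triangulation (m + j) F"
      "\<And>a b. (a, b) \<in> darts F \<Longrightarrow> a < m \<or> b < m"
      "card (old F) + 3 * j + 12 = 6 * m"
      "\<And>v. card (nbrs F v) + card (nbrs (old F) v) \<le> 12"
      by auto
    \<comment> \<open>Without an old face the count would force j + 4 = 2m, but one more insertion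
      is still within the bound.\<close>
    have "old F \<noteq> {}"
      using F(3) Suc.prems by (intro notI) simp
    then obtain a b c where abc: "(a, b, c) \<in> old F"
      by (metis all_not_in_conv prod_cases3)
    then have face: "(a, b, c) \<in> F" and lt: "a < m" "b < m" "c < m"
      by (auto simp: old_iff)
    note f = is_triangulation_face[OF F(1) face] face
    let ?F = "insert_vertex (m + j) a b c F"
    \<comment> \<open>All new triples contain \<open>m + j\<close>, which is not an original
      vertex.\<close>
    have old': "old ?F = old F - rots a b c"
      by (auto simp: old_iff insert_vertex_iff rots_iff)
    have sub: "rots a b c \<subseteq> old F"
      using f lt by (auto simp: old_iff rots_def)
    have c3: "card (rots a b c) = 3"
      using f by (auto simp: rots_def)
    have fin: "finite (old F)"
      using is_triangulation_finite[OF F(1)] by (simp add: old_def)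
    have tri': "is_triangulation (m + Suc j) ?F"
      using is_triangulation_insert_vertex[OF F(1) face] by simp
    moreover have "x < m \<or> y < m" if "(x, y) \<in> darts ?F" for x y
      using that F(2) lt unfolding darts_insert_vertex[OF F(1) face] by auto
    moreover have "card (old ?F) + 3 * Suc j + 12 = 6 * m"
      using F(3) card_Diff_subset[OF finite_subset[OF sub fin] sub] card_mono[OF fin sub] c3
      unfolding old' by simp
    moreover have "card (nbrs ?F v) + card (nbrs (old ?F) v) \<le> 12" for v
    proof -
      note nbrs' = nbrs_insert_vertex[OF F(1) face, of v]
      have finN: "finite (nbrs F v)"
        by (rule is_triangulation_finite_nbrs[OF F(1)])
      have "nbrs (old F) v \<subseteq> nbrs F v"
        by (auto simp: nbrs_iff darts_iff old_iff)
      then have finO: "finite (nbrs (old F) v)"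
        using finN by (rule finite_subset)
      have subO: "nbrs (old ?F) v \<subseteq> nbrs (old F) v"
        by (auto simp: nbrs_iff darts_iff old')
      consider "v = m + j" | "v \<in> {a, b, c}" "v \<noteq> m + j" | "v \<notin> {a, b, c}" "v \<noteq> m + j"
        by blast
      then show ?thesis
      proof cases
        case 1
        then have "nbrs (old ?F) v = {}"
          by (auto simp: nbrs_iff darts_iff old_iff)
        moreover have "card (nbrs ?F v) \<le> 12"
          using 1 f(4-6) unfolding nbrs' by simp
        ultimately show ?thesis by simp
      next
        case 2
        then obtain p q where pq: "(v, p, q) \<in> rots a b c"
          by (auto simp: rots_iff)
        then have pq': "(v, p, q) \<in> old F"
          using sub by blast
        \<comment> \<open>The removed face was the only old one on the dart \<open>(v, p)\<close>,
          so \<open>p\<close> drops out of the old neighbours and pays for the new neighbour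
          \<open>m + j\<close>.\<close>
        have "q' = q" if "(v, p, q') \<in> old F" for q'
          using that pq' is_triangulation_unique[OF F(1)] by (auto simp: old_iff)
        then have "p \<notin> nbrs (old ?F) v"
          using pq by (auto simp: nbrs_iff darts_iff old')
        moreover have "p \<in> nbrs (old F) v"
          using pq' by (auto simp: nbrs_iff darts_iff)
        ultimately have "card (nbrs (old ?F) v) < card (nbrs (old F) v)"
          using subO finO by (intro psubset_card_mono) auto
        moreover have "card (nbrs ?F v) \<le> Suc (card (nbrs F v))"
          using 2 finN by (simp add: nbrs' card_insert_if)
        ultimately show ?thesis
          using F(4)[of v] by simp
      next
        case 3
        then show ?thesis
          using F(4)[of v] card_mono[OF finO subO] by (simp add: nbrs')
      qed
    qed
    ultimately show ?case by blast
  qed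
  then show ?thesis
    by (meson add_leD1)
qed

section \<open>A triangulation whose non-hub vertices form a path\<close>

text \<open>Each new vertex goes into the face formed by the hubs 0, 1 and the latest vertex; the
  non-hub vertices thus become the path 2, 3, ..., n - 1.\<close>

lemma ex_triangulation_two_hubs:
  assumes "n \<ge> 3"
  shows "\<exists>F. is_triangulation n F \<and> (\<forall>v. v \<notin> {0, 1} \<longrightarrow> card (nbrs F v - {0, 1}) \<le> 2)"
proof -
  \<comment> \<open>The induction also carries the face for the next insertion and the fact that the
    end of the path can still take a second neighbour.\<close>
  have "\<exists>F. is_triangulation n F \<and> (\<forall>v. v \<notin> {0, 1} \<longrightarrow> card (nbrs F v - {0, 1}) \<le> 2) \<and>
    (0, 1, n - 1) \<in> F \<and> card (nbrs F (n - 1) - {0, 1}) \<le> 1"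
    using assms
  proof (induction n rule: dec_induct)
    case base
    let ?F = "rots 0 1 2 \<union> rots 0 2 1 :: tri"
    have "nbrs ?F v - {0, 1} \<subseteq> {2}" for v
      by (auto simp: nbrs_iff darts_iff rots_iff)
    then have "card (nbrs ?F v - {0, 1}) \<le> card {2::nat}" for v
      by (intro card_mono) auto
    then have "card (nbrs ?F v - {0, 1}) \<le> 1" for v
      by simp
    moreover from this have "card (nbrs ?F v - {0, 1}) \<le> 2" for v
      by (meson le_trans one_le_numeral)
    moreover have "(0, 1, 3 - 1) \<in> ?F"
      by (simp add: rots_iff)
    ultimately show ?case
      using is_triangulation_triangle by (intro exI[of _ ?F]) blast
  next
    case (step n)
    then obtain F where F: "is_triangulation n F"
      "\<And>v. v \<notin> {0, 1} \<Longrightarrow> card (nbrs F v - {0, 1}) \<le> 2"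
      and face: "(0, 1, n - 1) \<in> F" and last: "card (nbrs F (n - 1) - {0, 1}) \<le> 1"
      by blast
    let ?F = "insert_vertex n 0 1 (n - 1) F"
    note nbrs' = nbrs_insert_vertex[OF F(1) face]
    have fin: "finite (nbrs F v - {0, 1})" for v
      using is_triangulation_finite_nbrs[OF F(1)] by simp
    have "nbrs ?F n - {0, 1} = {n - 1}"
      using step.hyps unfolding nbrs' by auto
    then have new: "card (nbrs ?F n - {0, 1}) = 1"
      by simp
    have "card (nbrs ?F v - {0, 1}) \<le> 2" if v: "v \<notin> {0, 1}" for v
    proof -
      consider "v = n" | "v = n - 1" "v \<noteq> n" | "v \<noteq> n" "v \<noteq> n - 1" by blast
      then show ?thesis
      proof cases
        case 1
        then show ?thesis using new by simp
      next
        case 2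
        then have "nbrs ?F v - {0, 1} = insert n (nbrs F v - {0, 1})"
          using step.hyps unfolding nbrs' by auto
        then show ?thesis
          using last 2 fin[of v] by (simp add: card_insert_if)
      next
        case 3
        then show ?thesis using F(2)[OF v] v unfolding nbrs' by auto
      qed
    qed
    moreover have "(0, 1, Suc n - 1) \<in> ?F"
      by (simp add: insert_vertex_iff rots_iff)
    moreover have "card (nbrs ?F (Suc n - 1) - {0, 1}) \<le> 1"
      using new by simp
    ultimately show ?case
      using is_triangulation_insert_vertex[OF F(1) face] by blast
  qed
  then show ?thesis by blast
qed

section \<open>Counting common edges\<close>

text \<open>The four sides of the quadrilateral are edges already, so the diagonal
  \<open>{c, d}\<close> is the only possible gain.\<close>

lemma tri_edges_flip:
  assumes "flip_rel n F F'"
  shows "\<exists>e. tri_edges F' \<subseteq> insert e (tri_edges F)"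
proof -
  obtain a b c d where tri: "is_triangulation n F"
    and abc: "(a, b, c) \<in> F" and bad: "(b, a, d) \<in> F"
    and F': "F' = (F - rots a b c - rots b a d) \<union> rots c a d \<union> rots d b c"
    using assms unfolding flip_rel_def by blast
  have sub: "darts F' \<subseteq> darts F \<union> {(c, d), (d, c)}"
  proof (rule subrelI)
    fix x y assume "(x, y) \<in> darts F'"
    then obtain z where z: "(x, y, z) \<in> F \<or> (x, y, z) \<in> rots c a d \<or> (x, y, z) \<in> rots d b c"
      by (auto simp: F' darts_iff)
    have "(c, a) \<in> darts F" "(a, d) \<in> darts F" "(d, b) \<in> darts F" "(b, c) \<in> darts F"
      using is_triangulation_face(7,8)[OF tri abc] is_triangulation_face(7,8)[OF tri bad]
      unfolding darts_iff by blast+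
    moreover have "(x, y) \<in> darts F" if "(x, y, z) \<in> F"
      using that unfolding darts_iff by blast
    ultimately show "(x, y) \<in> darts F \<union> {(c, d), (d, c)}"
      using z unfolding rots_iff by (elim disjE conjE) simp_all
  qed
  have "{x, y} \<in> insert {c, d} (tri_edges F)" if "(x, y) \<in> darts F'" for x y
    using sub that by (auto simp: tri_edges_altdef)
  then have "tri_edges F' \<subseteq> insert {c, d} (tri_edges F)"
    unfolding tri_edges_altdef[of F'] by (intro image_subsetI) (auto split: prod.split)
  then show ?thesis ..
qed

lemma tri_edges_image:
  "tri_edges ((\<lambda>(a, b, c). (\<phi> a, \<phi> b, \<phi> c)) ` F) = (`) \<phi> ` tri_edges F"
proof -
  have "darts ((\<lambda>(a, b, c). (\<phi> a, \<phi> b, \<phi> c)) ` F) = map_prod \<phi> \<phi> ` darts F"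
    by (force simp: darts_def)
  then show ?thesis
    by (simp add: tri_edges_altdef image_image case_prod_unfold)
qed

text \<open>Each step of a path is a flip followed by a relabelling. Composing the relabellings
  gives one bijection for the whole path, and each flip adds at most one edge outside the image of
  \<open>G\<close>.\<close>

lemma card_new_edges_le_flips:
  assumes "is_triangulation n G" "flip_path n k G H"
  shows "is_triangulation n H \<and>
    (\<exists>\<phi>. bij_betw \<phi> {..<n} {..<n} \<and> card (tri_edges H - (`) \<phi> ` tri_edges G) \<le> k)"
  using assms(2) unfolding flip_path_def
proof (induction k arbitrary: H)
  case 0
  then show ?case
    using assms(1) by (auto intro!: exI[of _ id])
next
  case (Suc k)
  then obtain K where K: "(flip_adj n ^^ k) G K" and KH: "flip_adj n K H"
    by auto
  then obtain \<phi> where tri: "is_triangulation n K" and \<phi>: "bij_betw \<phi> {..<n} {..<n}"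
    and le: "card (tri_edges K - (`) \<phi> ` tri_edges G) \<le> k"
    using Suc.IH by blast
  obtain H' \<psi> where H: "is_triangulation n H" and flip: "flip_rel n K H'"
    and \<psi>: "bij_betw \<psi> {..<n} {..<n}" and H': "H = (\<lambda>(a, b, c). (\<psi> a, \<psi> b, \<psi> c)) ` H'"
    using KH unfolding flip_adj_def tri_iso_def by blast
  obtain e where sub: "tri_edges H' \<subseteq> insert e (tri_edges K)"
    using tri_edges_flip[OF flip] by blast
  \<comment> \<open>No injectivity is involved: a point whose image avoids the image of
    \<open>X\<close> itself avoids \<open>X\<close>.\<close>
  have image_diff: "f ` A - f ` X \<subseteq> insert (f e) (f ` (B - X))" if "A \<subseteq> insert e B"
    for f :: "nat set \<Rightarrow> nat set" and A B X
    using that by auto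
  have "(`) (\<psi> \<circ> \<phi>) ` tri_edges G = (`) \<psi> ` (`) \<phi> ` tri_edges G"
    by (simp add: image_image image_comp)
  then have "tri_edges H - (`) (\<psi> \<circ> \<phi>) ` tri_edges G \<subseteq>
    insert (\<psi> ` e) ((`) \<psi> ` (tri_edges K - (`) \<phi> ` tri_edges G))" (is "?D \<subseteq> insert _ (_ ` ?C)")
    unfolding H' tri_edges_image by (simp only: image_diff[OF sub])
  moreover have fin: "finite ?C"
    using is_triangulation_finite_edges[OF tri] by simp
  ultimately have "card ?D \<le> card (insert (\<psi> ` e) ((`) \<psi> ` ?C))"
    by (intro card_mono) auto
  also have "\<dots> \<le> Suc (card ((`) \<psi> ` ?C))"
    using fin by (simp add: card_insert_if)
  also have "\<dots> \<le> Suc k"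
    using card_image_le[OF fin, of "(`) \<psi>"] le by simp
  finally show ?case
    using H bij_betw_trans[OF \<phi> \<psi>] by blast
qed

section \<open>Edges common to both triangulations\<close>

text \<open>A common edge at a hub comes from an edge of \<open>G\<close> at one of the two
  preimages of the hubs: at most 2d of these. Any other has an end that is the image of a cover
  vertex and joins two non-hubs in \<open>H\<close>: at most two for each of the m cover
  vertices.\<close>

lemma card_common_edges_le:
  assumes G: "is_triangulation n G" and H: "is_triangulation n H"
    and \<phi>: "bij_betw \<phi> {..<n} {..<n}" and n: "n \<ge> 3"
    and cover: "\<And>a b. (a, b) \<in> darts G \<Longrightarrow> a < m \<or> b < m"
    and deg: "\<And>v. card (nbrs G v) \<le> d"
    and hubs: "\<And>v. v \<notin> {0, 1} \<Longrightarrow> card (nbrs H v - {0, 1}) \<le> 2"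
  shows "card (tri_edges H \<inter> (`) \<phi> ` tri_edges G) \<le> 2 * d + 2 * m"
proof -
  have surj: "\<phi> ` {..<n} = {..<n}"
    using \<phi> by (simp add: bij_betw_def)
  have "0 \<in> \<phi> ` {..<n}" "1 \<in> \<phi> ` {..<n}"
    using n unfolding surj by auto
  then obtain p q where p: "p < n" "\<phi> p = 0" and q: "q < n" "\<phi> q = 1"
    by auto
  have eqp: "x = p" if "\<phi> x = 0" "x < n" for x
    using that p \<phi> by (auto simp: bij_betw_def inj_on_def)
  have eqq: "x = q" if "\<phi> x = 1" "x < n" for x
    using that q \<phi> by (auto simp: bij_betw_def inj_on_def)
  \<comment> \<open>\<open>A r\<close> collects the images of the \<open>G\<close>-edges at
    \<open>r\<close>; \<open>B x\<close> the \<open>H\<close>-edges from the image of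
    \<open>x\<close> to non-hubs. \<open>M\<close> keeps the cover vertices not sent to a hub, the
    ones to which the bound 2 applies.\<close>
  define A where "A r = (\<lambda>y. {\<phi> r, \<phi> y}) ` nbrs G r" for r
  define M where "M = {x \<in> {..<m}. \<phi> x \<notin> {0, 1}}"
  define B where "B x = (\<lambda>w. {\<phi> x, w}) ` (nbrs H (\<phi> x) - {0, 1})" for x
  have finA: "finite (A r)" and cardA: "card (A r) \<le> d" for r
    using is_triangulation_finite_nbrs[OF G, of r] card_image_le deg[of r] le_trans
    unfolding A_def by blast+
  have finB: "finite (B x)" for x
    using is_triangulation_finite_nbrs[OF H] by (simp add: B_def)
  have finHx: "finite (nbrs H (\<phi> x) - {0, 1})" for x
    using is_triangulation_finite_nbrs[OF H] by simp
  have cardB: "card (B x) \<le> 2" if "x \<in> M" for x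
    using card_image_le[OF finHx[of x]] hubs[of "\<phi> x"] that le_trans
    unfolding B_def M_def by blast
  have finM: "finite M" and cardM: "card M \<le> m"
    using card_mono[of "{..<m}" M] by (auto simp: M_def)
  have "tri_edges H \<inter> (`) \<phi> ` tri_edges G \<subseteq> A p \<union> A q \<union> (\<Union>x\<in>M. B x)"
  proof
    fix e assume e: "e \<in> tri_edges H \<inter> (`) \<phi> ` tri_edges G"
    then obtain x0 y0 where xy0: "(x0, y0) \<in> darts G" "e = {\<phi> x0, \<phi> y0}"
      by (auto simp: tri_edges_altdef)
    \<comment> \<open>The edge is directed so that its first end lies in the cover.\<close>
    obtain x y where xy: "(x, y) \<in> darts G" "x < m" and exy: "e = {\<phi> x, \<phi> y}"
    proof (cases "x0 < m")
      case True
      then show ?thesis using that xy0 by blast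
    next
      case False
      then show ?thesis
        using that[of y0 x0] cover xy0 is_triangulation_sym[OF G xy0(1)]
        by (auto simp: insert_commute)
    qed
    have ltn: "x < n" "y < n"
      using is_triangulation_darts[OF G xy(1)] by auto
    have yx: "(y, x) \<in> darts G"
      by (rule is_triangulation_sym[OF G xy(1)])
    have mem: "e \<in> A x" "e \<in> A y"
      using xy(1) yx exy by (auto simp: A_def nbrs_iff)
    show "e \<in> A p \<union> A q \<union> (\<Union>x\<in>M. B x)"
    proof (cases "\<phi> x \<in> {0, 1} \<or> \<phi> y \<in> {0, 1}")
      case True
      then have "x = p \<or> x = q \<or> y = p \<or> y = q"
        using eqp eqq ltn by blast
      then show ?thesis using mem by blast
    next
      case False
      obtain u w where uw: "(u, w) \<in> darts H" "e = {u, w}"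
        using e by (auto simp: tri_edges_altdef)
      then have "(\<phi> x, \<phi> y) \<in> darts H"
        using exy is_triangulation_sym[OF H uw(1)] by (auto simp: doubleton_eq_iff)
      then have "e \<in> B x"
        using False exy by (auto simp: B_def nbrs_iff)
      then show ?thesis
        using False xy(2) by (auto simp: M_def)
    qed
  qed
  then have "card (tri_edges H \<inter> (`) \<phi> ` tri_edges G) \<le> card (A p \<union> A q \<union> (\<Union>x\<in>M. B x))"
    using finA finB finM by (intro card_mono) auto
  also have "\<dots> \<le> card (A p) + card (A q) + card (\<Union>x\<in>M. B x)"
    by (meson add_le_mono1 card_Un_le le_trans)
  also have "card (\<Union>x\<in>M. B x) \<le> (\<Sum>x\<in>M. card (B x))"
    by (rule card_UN_le[OF finM])
  also have "\<dots> \<le> (\<Sum>x\<in>M. 2)"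
    by (intro sum_mono cardB)
  also have "\<dots> \<le> 2 * m"
    using cardM by simp
  finally show ?thesis
    using cardA[of p] cardA[of q] by simp
qed

section \<open>Choice of the parameters and the final count\<close>

theorem theorem1:
  fixes n :: nat
  assumes "n \<ge> 3"
  shows "\<exists>G H. is_triangulation n G \<and> is_triangulation n H \<and>
           (\<forall>k. flip_path n k G H \<longrightarrow> 7 * real n / 3 - 34 \<le> real k)"
proof -
  \<comment> \<open>The least m with n - m \<le> 2m - 4, so that the faces of the path cube can host
    all remaining vertices; a smaller m means fewer common edges.\<close>
  define m where "m = (n + 6) div 3"
  have m: "m \<ge> 3" "m \<le> n" "n - m + 4 \<le> 2 * m" "3 * m \<le> n + 6"
    using assms unfolding m_def by linarith+
  obtain G where G: "is_triangulation n G" "\<And>a b. (a, b) \<in> darts G \<Longrightarrow> a < m \<or> b < m"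
    "\<And>v. card (nbrs G v) \<le> 12"
    using ex_triangulation_small_cover[OF m(1,3)] m(2) by auto
  obtain H where H: "is_triangulation n H"
    "\<And>v. v \<notin> {0, 1} \<Longrightarrow> card (nbrs H v - {0, 1}) \<le> 2"
    using ex_triangulation_two_hubs[OF assms] by blast
  have "7 * real n / 3 - 34 \<le> real k" if path: "flip_path n k G H" for k
  proof -
    obtain \<phi> where \<phi>: "bij_betw \<phi> {..<n} {..<n}"
      and new: "card (tri_edges H - (`) \<phi> ` tri_edges G) \<le> k"
      using card_new_edges_le_flips[OF G(1) path] by blast
    have "card (tri_edges H \<inter> (`) \<phi> ` tri_edges G) \<le> 2 * 12 + 2 * m"
      by (rule card_common_edges_le[OF G(1) H(1) \<phi> assms G(2,3) H(2)])
    moreover have "card (tri_edges H) = card (tri_edges H \<inter> (`) \<phi> ` tri_edges G) +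
      card (tri_edges H - (`) \<phi> ` tri_edges G)"
      by (rule card_Int_Diff[OF is_triangulation_finite_edges[OF H(1)]])
    moreover have "int (card (tri_edges H)) = 3 * int n - 6"
      using H(1) unfolding is_triangulation_def by blast
    \<comment> \<open>From 3n - 6 \<le> 24 + 2m + k and 3m \<le> n + 6, multiplied out by 3: 18 + 72
      + 12 = 102 = 3 * 34.\<close>
    ultimately have "7 * n \<le> 3 * k + 102"
      using new m(4) by linarith
    then show ?thesis by linarith
  qed
  then show ?thesis
    using G(1) H(1) by blast
qed

end
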